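(* Let $T$ be a directed tree, i.e., a directed graph whose underlying undirected graph is a tree. Then $\operatorname{Pic}(T)$ is torsion-free, that is, $\operatorname{Jac}(T)=0$.
   Context: A directed graph $G$ has a finite nonempty vertex set $V(G)=\{v_1,\dots,v_n\}$ and a finite collection of arrows (no loops). Each arrow joins two distinct vertices and is either one-directional (from $v_i$ to $v_j$) or bi-directional (between $v_i$ and $v_j$); a bi-directional arrow counts both as an arrow from $v_i$ to $v_j$ and as an arrow from $v_j$ to $v_i$. The underlying undirected graph of $G$ has the same vertices, with an edge between $v_i,v_j$ iff $G$ has some arrow between them. The Laplacian $L_G$ is the $n\times n$ integer matrix whose $(i,i)$ entry is the number of outgoing arrows of $v_i$ and whose $(i,j)$ entry, $i\neq j$, is minus the number of arrows from $v_i$ to $v_j$. The Picard group is $\operatorname{Pic}(G)=\mathbb{Z}^n/L_G^T\mathbb{Z}^n$, and the Jacobian $\operatorname{Jac}(G)$ is its torsion subgroup.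
   Formalization: The directed tree is assumed to have at most one arrow from u to w for each ordered pair of vertices; without this the claim is false: two vertices with two arrows from v1 to v2 give Pic = Z + Z/2. *)

theory Defs
  imports
    "HOL-Algebra.Coset"
    "HOL-Library.Multiset"
    "Jordan_Normal_Form.Matrix"
begin

section \<open>Directed graphs with one- and bi-directional arrows\<close>

text \<open>
  A bi-directional arrow is a single arrow that counts in both directions;
  \<open>Bidir u w\<close> and \<open>Bidir w u\<close> describe the same kind of arrow, and nothing below
  distinguishes them.
\<close>

datatype 'v arrow = Onedir 'v 'v | Bidir 'v 'v

fun from_to :: "'v arrow \<Rightarrow> 'v \<Rightarrow> 'v \<Rightarrow> bool" where
  "from_to (Onedir a b) u w \<longleftrightarrow> u = a \<and> w = b"
| "from_to (Bidir a b) u w \<longleftrightarrow> (u = a \<and> w = b) \<or> (u = b \<and> w = a)"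

text \<open>
  The vertex set comes with the enumeration \<open>v\<^sub>1, \<dots>, v\<^sub>n\<close> that indexes the rows and
  columns of the Laplacian (counted from 0).  The arrows form a multiset, so that
  \<open>the number of arrows from u to w\<close> can a priori be any natural number.
\<close>

record 'v dgraph =
  vertices :: "'v list"
  arrows :: "'v arrow multiset"

locale directed_graph =
  fixes G :: "'v dgraph"
  assumes distinct_vertices: "distinct (vertices G)"
    and vertices_nonempty: "vertices G \<noteq> []"
    and arrow_ends: "e \<in># arrows G \<Longrightarrow> from_to e u w
          \<Longrightarrow> u \<in> set (vertices G) \<and> w \<in> set (vertices G)"
    and no_loops: "e \<in># arrows G \<Longrightarrow> \<not> from_to e u u"

definition num_arrows :: "'v dgraph \<Rightarrow> 'v \<Rightarrow> 'v \<Rightarrow> nat" where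
  "num_arrows G u w = size {# e \<in># arrows G. from_to e u w #}"

definition out_degree :: "'v dgraph \<Rightarrow> 'v \<Rightarrow> nat" where
  "out_degree G u = size {# e \<in># arrows G. \<exists>w. from_to e u w #}"

text \<open>
  At most one arrow from \<open>u\<close> to \<open>w\<close>, for each ordered pair.  Two opposite
  one-directional arrows are allowed; they contribute to the Laplacian exactly what
  one bi-directional arrow does.  Without this condition directed trees can have
  torsion: two arrows from \<open>v\<^sub>1\<close> to \<open>v\<^sub>2\<close> on two vertices give
  a Picard group isomorphic to the direct sum of the integers and the integers mod 2.
\<close>

definition no_parallel_arrows :: "'v dgraph \<Rightarrow> bool" where
  "no_parallel_arrows G \<longleftrightarrow> (\<forall>u w. num_arrows G u w \<le> 1)"


section \<open>Directed trees\<close>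

text \<open>
  The notion of tree in the AFP entry Graph-Theory only forbids directed cycles and is
  therefore not the one needed for the underlying undirected graph.  Here undirected
  graphs are given by a vertex set and a set of two-element edges.
\<close>

definition underlying_edges :: "'v dgraph \<Rightarrow> 'v set set" where
  "underlying_edges G = {{u, w} | u w. \<exists>e. e \<in># arrows G \<and> from_to e u w}"

definition walk :: "'v set set \<Rightarrow> 'v list \<Rightarrow> bool" where
  "walk E p \<longleftrightarrow> p \<noteq> [] \<and> successively (\<lambda>u w. {u, w} \<in> E) p"

definition connected_graph :: "'v set \<Rightarrow> 'v set set \<Rightarrow> bool" where
  "connected_graph V E \<longleftrightarrow>
     V \<noteq> {} \<and> (\<forall>u\<in>V. \<forall>w\<in>V. \<exists>p. walk E p \<and> hd p = u \<and> last p = w)"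

definition cycle :: "'v set set \<Rightarrow> 'v list \<Rightarrow> bool" where
  "cycle E p \<longleftrightarrow> length p \<ge> 3 \<and> distinct p \<and> walk E p \<and> {last p, hd p} \<in> E"

definition tree :: "'v set \<Rightarrow> 'v set set \<Rightarrow> bool" where
  "tree V E \<longleftrightarrow> connected_graph V E \<and> (\<nexists>p. cycle E p)"

locale directed_tree = directed_graph G for G :: "'v dgraph" +
  assumes underlying_tree: "tree (set (vertices G)) (underlying_edges G)"


section \<open>Laplacian, Picard group and Jacobian\<close>

definition laplacian :: "'v dgraph \<Rightarrow> int mat" where
  "laplacian G = (let vs = vertices G; n = length vs in
     mat n n (\<lambda>(i, j). if i = j then int (out_degree G (vs ! i))
                       else - int (num_arrows G (vs ! i) (vs ! j))))"

text \<open>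
  The additive group of integer vectors is \<open>monoid_vec\<close>, written multiplicatively as
  usual in HOL-Algebra; its power \<open>x [^] k\<close> is the multiple \<open>k x\<close>.
\<close>

definition picard_group :: "'v dgraph \<Rightarrow> int vec set monoid" where
  "picard_group G = (let n = length (vertices G) in
     monoid_vec TYPE(int) n Mod
       ((\<lambda>x. transpose_mat (laplacian G) *\<^sub>v x) ` carrier_vec n))"

definition torsion :: "('a, 'm) monoid_scheme \<Rightarrow> 'a set" where
  "torsion H = {x \<in> carrier H. \<exists>k::nat. k > 0 \<and> x [^]\<^bsub>H\<^esub> k = \<one>\<^bsub>H\<^esub>}"

definition torsion_free :: "('a, 'm) monoid_scheme \<Rightarrow> bool" where
  "torsion_free H \<longleftrightarrow>
     (\<forall>x \<in> carrier H. \<forall>k::nat. k > 0 \<longrightarrow> x [^]\<^bsub>H\<^esub> k = \<one>\<^bsub>H\<^esub> \<longrightarrow> x = \<one>\<^bsub>H\<^esub>)"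

definition jacobian :: "'v dgraph \<Rightarrow> int vec set monoid" where
  "jacobian G = (picard_group G)\<lparr>carrier := torsion (picard_group G)\<rparr>"

lemma picard_group_comm_group: "comm_group (picard_group G)"
proof -
  let ?n = "length (vertices G)"
  let ?Z = "monoid_vec TYPE(int) ?n"
  let ?A = "transpose_mat (laplacian G)"
  let ?I = "(\<lambda>x. ?A *\<^sub>v x) ` carrier_vec ?n"
  interpret Z: comm_group ?Z by (rule comm_group_vec)
  have A: "?A \<in> carrier_mat ?n ?n"
    by (auto simp: laplacian_def Let_def)
  have "(\<lambda>x. ?A *\<^sub>v x) \<in> hom ?Z ?Z"
    using A by (auto simp: hom_def monoid_vec_simps mult_add_distrib_mat_vec)
  then have "group_hom ?Z ?Z (\<lambda>x. ?A *\<^sub>v x)"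
    by (simp add: group_hom_def group_hom_axioms_def Z.group_axioms)
  then have "subgroup ?I ?Z"
    using group_hom.img_is_subgroup by (fastforce simp: monoid_vec_simps)
  then show ?thesis
    unfolding picard_group_def Let_def by (rule Z.abelian_FactGroup)
qed

end

theory Submission
  imports Defs
begin

text \<open>
  For a vector \<open>x\<close> the \<open>u\<close>-coordinate of \<open>L\<^sup>T x\<close> is the net outflow at \<open>u\<close> of the antisymmetric
  flow \<open>f u w = N u w * x u - N w u * x w\<close>, where \<open>N u w\<close> counts the arrows from \<open>u\<close> to \<open>w\<close>.  Suppose
  \<open>k y = L\<^sup>T x\<close>, and let \<open>r = x mod k\<close>.  All net outflows of the flow of \<open>r\<close> are divisible by \<open>k\<close>;
  since the flow lives on a forest, each of its values is divisible by \<open>k\<close>.  But these values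
  have modulus less than \<open>k\<close>, because \<open>N \<le> 1\<close>.  Hence \<open>L\<^sup>T r = 0\<close>, and \<open>y = L\<^sup>T (x div k)\<close>.
\<close>

section \<open>Flows on forests\<close>

text \<open>Call a pair bad if \<open>k\<close> does not divide its flow value. Since the net
  outflow at a vertex is divisible by \<open>k\<close>, a vertex in one bad pair lies in a second
  one. So the bad pairs form a finite forest without leaves, and such a forest has no edges.\<close>

lemma forest_flow_dvd:
  fixes f :: "'v \<Rightarrow> 'v \<Rightarrow> int"
  assumes fin: "finite V"
    and acyc: "\<nexists>p. cycle E p"
    and anti: "\<And>u w. f w u = - f u w"
    and supp: "\<And>u w. f u w \<noteq> 0 \<Longrightarrow> {u, w} \<in> E"
    and net: "\<And>u. u \<in> V \<Longrightarrow> k dvd (\<Sum>w\<in>V. f u w)"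
    and "u \<in> V" "w \<in> V"
  shows "k dvd f u w"
proof (rule ccontr)
  assume nd: "\<not> k dvd f u w"
  define R where "R a b \<longleftrightarrow> a \<in> V \<and> b \<in> V \<and> \<not> k dvd f a b" for a b
  have R_sym: "R b a" if "R a b" for a b
    using that anti[of a b] by (auto simp: R_def)
  have R_irrefl: "\<not> R a a" for a
    using anti[of a a] by (auto simp: R_def)
  have R_E: "{a, b} \<in> E" if "R a b" for a b
  proof (rule supp)
    show "f a b \<noteq> 0" using that by (metis R_def dvd_0_right)
  qed
  have other: "\<exists>c. R a c \<and> c \<noteq> b" if "R a b" for a b
  proof (rule ccontr)
    assume "\<nexists>c. R a c \<and> c \<noteq> b"
    then have "k dvd f a c" if "c \<in> V - {b}" for c
      using that \<open>R a b\<close> by (auto simp: R_def)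
    then have "k dvd (\<Sum>c\<in>V - {b}. f a c)"
      by (rule dvd_sum)
    moreover have "(\<Sum>c\<in>V. f a c) = f a b + (\<Sum>c\<in>V - {b}. f a c)"
      using that fin by (simp add: R_def sum.remove)
    moreover have "k dvd (\<Sum>c\<in>V. f a c)"
      using that net by (simp add: R_def)
    ultimately have "k dvd f a b"
      by (simp add: dvd_add_left_iff)
    with that show False by (simp add: R_def)
  qed
  \<comment> \<open>A bad pair starts a path that can be extended at its head \<open>a\<close>
    forever: \<open>other\<close> supplies a bad neighbour of \<open>a\<close> different from
    \<open>b\<close>.\<close>
  have long: "\<exists>a b p. successively R (a # b # p) \<and> distinct (a # b # p) \<and>
      set (a # b # p) \<subseteq> V \<and> length p = m" for m
  proof (induction m)
    case 0
    have "R u w" using nd \<open>u \<in> V\<close> \<open>w \<in> V\<close> by (simp add: R_def)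
    then show ?case
      using R_irrefl by (intro exI[of _ u] exI[of _ w] exI[of _ "[]"]) (auto simp: R_def)
  next
    case (Suc m)
    then obtain a b p where p: "successively R (a # b # p)" "distinct (a # b # p)"
      "set (a # b # p) \<subseteq> V" "length p = m" by blast
    from p obtain c where c: "R a c" "c \<noteq> b" using other[of a b] by auto
    have "c \<noteq> a" using c R_irrefl by blast
    \<comment> \<open>If \<open>c\<close> were already on the path, the segment from
      \<open>a\<close> to \<open>c\<close> would close up to a cycle. It has at least three vertices
      because \<open>b\<close> lies strictly between them.\<close>
    have "c \<notin> set p"
    proof
      assume "c \<in> set p"
      then obtain q s where qs: "p = q @ c # s" by (auto simp: in_set_conv_decomp)
      have "successively R (a # b # q @ [c])"
        using p(1) unfolding qs
        using successively_append_iff[of R "a # b # q @ [c]" s] by simp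
      then have "successively (\<lambda>u w. {u, w} \<in> E) (a # b # q @ [c])"
        by (rule successively_mono) (use R_E in auto)
      moreover have "{c, a} \<in> E"
        using R_E R_sym c by blast
      ultimately have "cycle E (a # b # q @ [c])"
        using p(2) by (auto simp: cycle_def walk_def qs)
      with acyc show False by blast
    qed
    then show ?case
      using p c \<open>c \<noteq> a\<close> R_sym[OF c(1)]
      by (intro exI[of _ c] exI[of _ a] exI[of _ "b # p"]) (auto simp: R_def)
  qed
  \<comment> \<open>This path would have \<open>card V + 2\<close> distinct vertices inside
    \<open>V\<close>.\<close>
  from long[of "card V"] obtain a b p where
    "distinct (a # b # p)" "set (a # b # p) \<subseteq> V" "length p = card V" by blast
  then show False
    using card_mono[OF fin, of "set (a # b # p)"] distinct_card[of "a # b # p"] by simp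
qed


section \<open>The transposed Laplacian as net outflow\<close>

text \<open>Double counting: an element of \<open>M\<close> with a witness has exactly one, so it
  contributes to exactly one summand on the right.\<close>

lemma size_filter_mset_unique_witness:
  assumes "finite W"
    and "\<And>e w. e \<in># M \<Longrightarrow> P e w \<Longrightarrow> w \<in> W"
    and "\<And>e w w'. e \<in># M \<Longrightarrow> P e w \<Longrightarrow> P e w' \<Longrightarrow> w = w'"
  shows "size {# e \<in># M. \<exists>w. P e w #} = (\<Sum>w\<in>W. size {# e \<in># M. P e w #})"
  using assms(2,3)
proof (induction M)
  case empty
  then show ?case by simp
next
  case (add e M)
  have IH: "size {# e \<in># M. \<exists>w. P e w #} = (\<Sum>w\<in>W. size {# e \<in># M. P e w #})"
  proof (rule add.IH)
    show "w \<in> W" if "e' \<in># M" "P e' w" for e' w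
      using that add.prems(1)[of e' w] by simp
    show "w = w'" if "e' \<in># M" "P e' w" "P e' w'" for e' w w'
      using that add.prems(2)[of e' w w'] by simp
  qed
  have "(if \<exists>w. P e w then 1 else 0) = (\<Sum>w\<in>W. if P e w then 1 else (0::nat))"
  proof (cases "\<exists>w. P e w")
    case True
    then obtain w where w: "P e w" by blast
    have "(\<Sum>w\<in>W. if P e w then 1 else (0::nat)) = (\<Sum>v\<in>W. if v = w then 1 else 0)"
      using w add.prems(2)[of e] by (intro sum.cong) auto
    also have "\<dots> = 1" using w add.prems(1)[of e w] \<open>finite W\<close> by simp
    finally show ?thesis using True by simp
  next
    case False
    then show ?thesis by auto
  qed
  moreover have "size {# e \<in># add_mset e M. \<exists>w. P e w #} =
      (if \<exists>w. P e w then 1 else 0) + size {# e \<in># M. \<exists>w. P e w #}"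
    by simp
  moreover have "(\<Sum>w\<in>W. size {# e \<in># add_mset e M. P e w #}) =
      (\<Sum>w\<in>W. (if P e w then 1 else 0) + size {# e \<in># M. P e w #})"
    by (intro sum.cong) auto
  ultimately show ?case
    using IH by (simp add: sum.distrib)
qed

text \<open>Once its tail is fixed, an arrow has at most one head, even if it is
  bi-directional.\<close>

lemma (in directed_graph) out_degree_eq_sum:
  "out_degree G u = (\<Sum>w\<in>set (vertices G). num_arrows G u w)"
  unfolding out_degree_def num_arrows_def
proof (rule size_filter_mset_unique_witness)
  show "w \<in> set (vertices G)" if "e \<in># arrows G" "from_to e u w" for e w
    using arrow_ends that by blast
  show "w = w'" if "e \<in># arrows G" "from_to e u w" "from_to e u w'" for e w w'
    using that no_loops[of e] by (cases e) auto
qed simp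

lemma (in directed_graph) num_arrows_self: "num_arrows G u u = 0"
  using no_loops by (simp add: num_arrows_def)

lemma num_arrows_pos_underlying_edge:
  assumes "num_arrows G u w \<noteq> 0"
  shows "{u, w} \<in> underlying_edges G"
proof -
  obtain e where "e \<in># arrows G" "from_to e u w"
    using assms by (auto simp: num_arrows_def)
  then show ?thesis unfolding underlying_edges_def by blast
qed

lemma laplacian_dims [simp]:
  "laplacian G \<in> carrier_mat (length (vertices G)) (length (vertices G))"
  "dim_row (laplacian G) = length (vertices G)"
  "dim_col (laplacian G) = length (vertices G)"
  by (simp_all add: laplacian_def Let_def)

text \<open>Coordinates pass from indices to vertices through \<open>x'\<close>. Spreading the
  diagonal out-degree over the heads \<open>w\<close> makes each summand antisymmetric in its two
  vertices, as \<open>forest_flow_dvd\<close> demands.\<close>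

lemma (in directed_graph) transpose_laplacian_mult_vec:
  fixes x :: "int vec"
  assumes x: "x \<in> carrier_vec (length (vertices G))"
    and x': "\<And>i. i < length (vertices G) \<Longrightarrow> x' (vertices G ! i) = x $ i"
    and i: "i < length (vertices G)"
  shows "(transpose_mat (laplacian G) *\<^sub>v x) $ i =
    (\<Sum>w\<in>set (vertices G). int (num_arrows G (vertices G ! i) w) * x' (vertices G ! i)
       - int (num_arrows G w (vertices G ! i)) * x' w)"
proof -
  let ?vs = "vertices G" let ?n = "length ?vs"
  let ?u = "?vs ! i"
  have nth_neq: "?vs ! j \<noteq> ?u" if "j < ?n" "j \<noteq> i" for j
    using that i distinct_vertices by (simp add: nth_eq_iff_index_eq)
  have bij: "bij_betw ((!) ?vs) {0..<?n} (set ?vs)"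
    using distinct_vertices by (intro bij_betw_nth) auto
  have "(transpose_mat (laplacian G) *\<^sub>v x) $ i = (\<Sum>j\<in>{0..<?n}. laplacian G $$ (j, i) * x $ j)"
    using x i by (simp add: laplacian_def Let_def scalar_prod_def)
  \<comment> \<open>One formula covers both kinds of entries: for \<open>j = i\<close> the
    subtracted term vanishes by \<open>num_arrows_self\<close>.\<close>
  also have "\<dots> = (\<Sum>j\<in>{0..<?n}. (if ?vs ! j = ?u then int (out_degree G ?u)
      else 0) * x' (?vs ! j) - int (num_arrows G (?vs ! j) ?u) * x' (?vs ! j))"
    using i nth_neq by (intro sum.cong) (auto simp: laplacian_def Let_def x' num_arrows_self)
  also have "\<dots> = (\<Sum>w\<in>set ?vs. (if w = ?u then int (out_degree G ?u) else 0) * x' w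
      - int (num_arrows G w ?u) * x' w)"
    using sum.reindex_bij_betw[OF bij, of "\<lambda>w. (if w = ?u then int (out_degree G ?u) else 0) * x' w
      - int (num_arrows G w ?u) * x' w"] by simp
  also have "\<dots> = int (out_degree G ?u) * x' ?u - (\<Sum>w\<in>set ?vs. int (num_arrows G w ?u) * x' w)"
    using i by (simp add: sum_subtractf if_distrib[of "\<lambda>a. a * _"] sum.delta cong: if_cong)
  finally show ?thesis
    by (simp add: out_degree_eq_sum sum_subtractf sum_distrib_right)
qed

text \<open>Saturation of the lattice spanned by the columns of \<open>L^T\<close> is what makes its
  quotient torsion-free.\<close>

lemma (in directed_tree) transpose_laplacian_image_saturated:
  fixes x y :: "int vec"
  assumes simple: "no_parallel_arrows G"
    and x: "x \<in> carrier_vec (length (vertices G))"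
    and y: "y \<in> carrier_vec (length (vertices G))"
    and k: "k > 0"
    and xy: "transpose_mat (laplacian G) *\<^sub>v x = k \<cdot>\<^sub>v y"
  shows "\<exists>z \<in> carrier_vec (length (vertices G)). y = transpose_mat (laplacian G) *\<^sub>v z"
proof -
  let ?vs = "vertices G" let ?n = "length ?vs" let ?V = "set ?vs"
  let ?A = "transpose_mat (laplacian G)"
  let ?N = "\<lambda>u w. int (num_arrows G u w)"
  have A: "?A \<in> carrier_mat ?n ?n" by simp
  have "inj_on ((!) ?vs) {0..<?n}"
    using distinct_vertices by (intro inj_on_nth) auto
  \<comment> \<open>Off the vertex set \<open>x'\<close> is unspecified, which is harmless because
    the flow is only summed over vertices.\<close>
  define x' where "x' u = x $ (the_inv_into {0..<?n} ((!) ?vs) u)" for u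
  have x': "x' (?vs ! i) = x $ i" if "i < ?n" for i
    using that \<open>inj_on ((!) ?vs) {0..<?n}\<close> by (simp add: x'_def the_inv_into_f_f)
  define z where "z = vec ?n (\<lambda>i. x $ i div k)"
  define r where "r = vec ?n (\<lambda>i. x $ i mod k)"
  have z: "z \<in> carrier_vec ?n" and r: "r \<in> carrier_vec ?n"
    by (auto simp: z_def r_def)
  have "x = k \<cdot>\<^sub>v z + r"
    using x by (intro eq_vecI) (auto simp: z_def r_def)
  moreover have "?A *\<^sub>v (k \<cdot>\<^sub>v z) = k \<cdot>\<^sub>v (?A *\<^sub>v z)"
    using A z by (intro eq_vecI) simp_all
  ultimately have ky: "k \<cdot>\<^sub>v y = k \<cdot>\<^sub>v (?A *\<^sub>v z) + ?A *\<^sub>v r"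
    using xy mult_add_distrib_mat_vec[OF A, of "k \<cdot>\<^sub>v z" r] z r by simp
  have ky_nth: "k * y $ i = k * (?A *\<^sub>v z) $ i + (?A *\<^sub>v r) $ i" if "i < ?n" for i
  proof -
    have "(k \<cdot>\<^sub>v y) $ i = (k \<cdot>\<^sub>v (?A *\<^sub>v z) + ?A *\<^sub>v r) $ i" by (simp add: ky)
    then show ?thesis using that y A by simp
  qed
  define r' where "r' u = x' u mod k" for u
  define f where "f u w = ?N u w * r' u - ?N w u * r' w" for u w
  have Ar: "(?A *\<^sub>v r) $ i = (\<Sum>w\<in>?V. f (?vs ! i) w)" if "i < ?n" for i
    unfolding f_def
    by (rule transpose_laplacian_mult_vec[OF r _ that]) (simp add: r_def r'_def x')
  have net: "k dvd (\<Sum>w\<in>?V. f u w)" if u: "u \<in> ?V" for u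
  proof -
    obtain i where i: "i < ?n" "u = ?vs ! i"
      using u by (auto simp: in_set_conv_nth)
    have "(?A *\<^sub>v r) $ i = k * (y $ i - (?A *\<^sub>v z) $ i)"
      using ky_nth[OF i(1)] by (simp add: algebra_simps)
    then show ?thesis using Ar[OF i(1)] i by simp
  qed
  have "f u w = 0" if "u \<in> ?V" "w \<in> ?V" for u w
  proof -
    have "k dvd f u w"
    proof (rule forest_flow_dvd[of ?V "underlying_edges G" f])
      show "\<nexists>p. cycle (underlying_edges G) p"
        using underlying_tree by (simp add: tree_def)
      show "{u, w} \<in> underlying_edges G" if "f u w \<noteq> 0" for u w
        using that num_arrows_pos_underlying_edge[of G u w] num_arrows_pos_underlying_edge[of G w u]
        by (cases "num_arrows G u w = 0"; cases "num_arrows G w u = 0") (auto simp: f_def insert_commute)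
    qed (use net that in \<open>auto simp: f_def\<close>)
    \<comment> \<open>With arrow counts 0 or 1, \<open>f u w\<close> is a difference of two integers
      from 0 to \<open>k - 1\<close>. A second parallel arrow would break this bound.\<close>
    moreover have "\<bar>f u w\<bar> < k"
    proof -
      have "0 \<le> r' u" "r' u < k" "0 \<le> r' w" "r' w < k"
        using k by (simp_all add: r'_def)
      moreover have "num_arrows G u w \<in> {0, 1}" "num_arrows G w u \<in> {0, 1}"
        using simple by (auto simp: no_parallel_arrows_def le_Suc_eq)
      ultimately show ?thesis by (auto simp: f_def)
    qed
    ultimately show ?thesis
      using zdvd_not_zless[of "\<bar>f u w\<bar>" k] by auto
  qed
  then have "(?A *\<^sub>v r) $ i = 0" if "i < ?n" for i
    using Ar[OF that] that by simp
  then have "y = ?A *\<^sub>v z"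
    using ky_nth k y A by (intro eq_vecI) auto
  with z show ?thesis by blast
qed


section \<open>Torsion of quotient groups\<close>

text \<open>The projection is a homomorphism, so the \<open>k\<close>-th power of the coset of
  \<open>x\<close> is the coset of \<open>x [^] k\<close>; it is trivial only if
  \<open>x [^] k\<close> lies in \<open>H\<close>.\<close>

lemma (in comm_group) torsion_free_FactGroup:
  assumes H: "subgroup H G"
    and sat: "\<And>x k. x \<in> carrier G \<Longrightarrow> k > (0::nat) \<Longrightarrow> x [^] k \<in> H \<Longrightarrow> x \<in> H"
  shows "torsion_free (G Mod H)"
proof -
  interpret N: normal H G using H by (rule subgroup_imp_normal)
  have "X = \<one>\<^bsub>G Mod H\<^esub>"
    if X: "X \<in> carrier (G Mod H)" and k: "k > 0" and e: "X [^]\<^bsub>G Mod H\<^esub> k = \<one>\<^bsub>G Mod H\<^esub>"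
    for X and k :: nat
  proof -
    obtain x where x: "x \<in> carrier G" "X = H #> x"
      using X by (auto simp: FactGroup_def RCOSETS_def)
    have "H #> (x [^] k) = H"
      using e x hom_nat_pow[OF N.r_coset_hom_Mod x(1) is_group N.factorgroup_is_group, of k] by (simp add: FactGroup_def)
    then have "x [^] k \<in> H"
      using x rcos_self[OF _ H, of "x [^] k"] by simp
    then have "x \<in> H" using sat x k by blast
    then show ?thesis
      using x H by (simp add: FactGroup_def coset_join2)
  qed
  then show ?thesis by (auto simp: torsion_free_def)
qed

lemma (in group) torsion_eq_one:
  assumes "torsion_free G"
  shows "torsion G = {\<one>}"
  using assms by (auto simp: torsion_def torsion_free_def intro: exI[of _ 1])

lemma nat_pow_monoid_vec:
  fixes x :: "int vec"
  assumes "x \<in> carrier_vec n"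
  shows "x [^]\<^bsub>monoid_vec TYPE(int) n\<^esub> (k::nat) = int k \<cdot>\<^sub>v x"
proof (induction k)
  case 0
  show ?case using assms by (auto simp: nat_pow_def monoid_vec_simps)
next
  case (Suc k)
  then show ?case
    using assms by (auto simp: monoid_vec_simps nat_pow_def algebra_simps)
qed

theorem theorem3p2:
  fixes T :: "'v dgraph"
  assumes "directed_tree T"
    and "no_parallel_arrows T"
  shows "torsion_free (picard_group T) \<and> carrier (jacobian T) = {\<one>\<^bsub>jacobian T\<^esub>}"
proof -
  interpret directed_tree T by fact
  let ?n = "length (vertices T)"
  let ?Z = "monoid_vec TYPE(int) ?n"
  let ?A = "transpose_mat (laplacian T)"
  let ?I = "(\<lambda>x. ?A *\<^sub>v x) ` carrier_vec ?n"
  interpret Z: comm_group ?Z by (rule comm_group_vec)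
  interpret P: comm_group "picard_group T" by (rule picard_group_comm_group)
  have A: "?A \<in> carrier_mat ?n ?n" by simp
  have "group_hom ?Z ?Z (\<lambda>x. ?A *\<^sub>v x)"
    using mult_mat_vec_carrier[OF A] by unfold_locales
      (auto simp: hom_def monoid_vec_simps mult_add_distrib_mat_vec[OF A])
  then have I: "subgroup ?I ?Z"
    using group_hom.img_is_subgroup by (fastforce simp: monoid_vec_simps)
  have "torsion_free (?Z Mod ?I)"
  proof (rule Z.torsion_free_FactGroup[OF I])
    fix y k assume y: "y \<in> carrier ?Z" and "k > (0::nat)" and "y [^]\<^bsub>?Z\<^esub> k \<in> ?I"
    then obtain x where "x \<in> carrier_vec ?n" "?A *\<^sub>v x = int k \<cdot>\<^sub>v y"
      by (auto simp: nat_pow_monoid_vec monoid_vec_simps)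
    then show "y \<in> ?I"
      using transpose_laplacian_image_saturated[OF assms(2), of x y "int k"] y \<open>k > 0\<close>
      by (auto simp: monoid_vec_simps)
  qed
  then have "torsion_free (picard_group T)"
    by (simp add: picard_group_def Let_def)
  \<comment> \<open>\<open>jacobian\<close> replaces only the carrier, so its unit is still that of
    the Picard group.\<close>
  then show ?thesis
    using P.torsion_eq_one by (simp add: jacobian_def)
qed

end
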